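(* $[\mathcal{SDP}]_3=[\langle\mathcal{M}\rangle_\omega]_3$.
   Context: $\mathcal{B}_k$ is the set of functions $\{0,1\}^k\to\mathbb{R}_{\ge0}$, $\mathcal{B}=\bigcup_k\mathcal{B}_k$, and $[\mathcal{F}]_3=\mathcal{F}\cap\mathcal{B}_3$. $|\mathbf{x}|$ is Hamming weight, $\overline{\mathbf{x}}$ complement. $\mathrm{EQ}$ is the binary equality indicator. $\langle\mathcal{F}\rangle$ is the closure of $\mathcal{F}\cup\{\mathrm{EQ}\}$ under introducing fictitious arguments, permuting arguments, pointwise product of equal-arity functions, and summing out an argument over $\{0,1\}$; a $k$-ary $f$ is a limit of $\mathcal{F}$ if there is a finite $S\subseteq\mathcal{F}$ such that for all $\epsilon>0$ some $k$-ary $f_\epsilon\in\langle S\rangle$ has $\max_\mathbf{x}|f-f_\epsilon|<\epsilon$; $\langle\mathcal{F}\rangle_\omega$ is the closure of $\mathcal{F}\cup\{\mathrm{EQ}\}$ under the four operations and limits. Fourier transform: $\widehat f(\mathbf{x})=2^{-k}\sum_{\mathbf{w}}(-1)^{|\mathbf{w}\wedge\mathbf{x}|}f(\mathbf{w})$. An arity-$k$ match-circuit is an undirected graph with external degree-1 vertices $u_1,\dots,u_k$ whose incident edges $y_1,\dots,y_k$ (terminals) have weight 1, internal vertices $v_1,\dots,v_n$ ($n\ge k$), and weights $w_e>0$ on other edges; it implements $f(y_1,\dots,y_k)=\sum_H\prod_{e\in H}w_e$ over edge sets $H$ containing exactly the terminals set to 1 in which each internal vertex lies in exactly one edge. $\mathcal{M}=\{f\in\mathcal{B}:\widehat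 f$ is implemented by a match-circuit$\}$. $\mathcal{SDP}$ is the set of $f\in\mathcal{B}$ with $f(\mathbf{x})=f(\overline{\mathbf{x}})$ for all $\mathbf{x}$, $\widehat f(\mathbf{x})\ge0$ for all $\mathbf{x}$, and $\widehat f(\mathbf{x})\le0$ for all odd-weight $\mathbf{x}$. *)

theory Defs
  imports Complex_Main "HOL-Library.FuncSet" "HOL-Combinatorics.Permutations"
begin

text \<open>
  A function of arity \<open>k\<close> is a pair of \<open>k\<close> and a function on bit strings that is
  \<open>undefined\<close> off the cube, so that equality of pairs is equality of functions
  \<open>{0,1}\<^sup>k \<Rightarrow> real\<close>, and functions of different arity are never equal.
  \<open>True\<close> stands for 1. Argument positions are counted from 0.
\<close>

definition cube :: "nat \<Rightarrow> bool list set" where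
  "cube k = {x. length x = k}"

type_synonym bfun = "nat \<times> (bool list \<Rightarrow> real)"

definition B_arity :: "nat \<Rightarrow> bfun set" where
  "B_arity k = {k} \<times> (cube k \<rightarrow>\<^sub>E {0..})"

definition B_all :: "bfun set" where
  "B_all = (\<Union>k. B_arity k)"

definition arity_part :: "bfun set \<Rightarrow> nat \<Rightarrow> bfun set" where
  "arity_part F k = F \<inter> B_arity k"

definition hweight :: "bool list \<Rightarrow> nat" where
  "hweight x = count_list x True"

definition EQ :: bfun where
  "EQ = (2, \<lambda>x\<in>cube 2. if x ! 0 = x ! 1 then 1 else 0)"

definition add_arg :: "nat \<Rightarrow> bfun \<Rightarrow> bfun" where
  "add_arg i = (\<lambda>(k, f). (Suc k, \<lambda>x\<in>cube (Suc k). f (take i x @ drop (Suc i) x)))"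

definition permute_args :: "(nat \<Rightarrow> nat) \<Rightarrow> bfun \<Rightarrow> bfun" where
  "permute_args \<pi> = (\<lambda>(k, f). (k, \<lambda>x\<in>cube k. f (permute_list \<pi> x)))"

definition prod_bfun :: "bfun \<Rightarrow> bfun \<Rightarrow> bfun" where
  "prod_bfun = (\<lambda>(k, f) (_, g). (k, \<lambda>x\<in>cube k. f x * g x))"

definition sum_out :: "nat \<Rightarrow> bfun \<Rightarrow> bfun" where
  "sum_out i = (\<lambda>(k, f). (k - 1, \<lambda>x\<in>cube (k - 1). \<Sum>b\<in>UNIV. f (take i x @ b # drop i x)))"

inductive_set clone :: "bfun set \<Rightarrow> bfun set" for F where
  base: "h \<in> F \<Longrightarrow> h \<in> clone F"
| EQ: "EQ \<in> clone F"
| add_arg: "h \<in> clone F \<Longrightarrow> i \<le> fst h \<Longrightarrow> add_arg i h \<in> clone F"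
| permute_args: "h \<in> clone F \<Longrightarrow> \<pi> permutes {..<fst h} \<Longrightarrow> permute_args \<pi> h \<in> clone F"
| prod: "h \<in> clone F \<Longrightarrow> h' \<in> clone F \<Longrightarrow> fst h = fst h' \<Longrightarrow> prod_bfun h h' \<in> clone F"
| sum_out: "h \<in> clone F \<Longrightarrow> i < fst h \<Longrightarrow> sum_out i h \<in> clone F"

definition is_limit :: "bfun set \<Rightarrow> bfun \<Rightarrow> bool" where
  "is_limit F h \<longleftrightarrow> h \<in> B_all \<and>
     (\<exists>S. finite S \<and> S \<subseteq> F \<and>
        (\<forall>\<epsilon>>0. \<exists>g \<in> clone S. fst g = fst h \<and>
           (MAX x\<in>cube (fst h). \<bar>snd h x - snd g x\<bar>) < \<epsilon>))"

lemma is_limit_mono [mono]: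
  "(\<And>y. P y \<longrightarrow> Q y) \<Longrightarrow> is_limit {y. P y} h \<longrightarrow> is_limit {y. Q y} h"
proof
  assume PQ: "\<And>y. P y \<longrightarrow> Q y" and lim: "is_limit {y. P y} h"
  from PQ have sub: "S \<subseteq> {y. Q y}" if "S \<subseteq> {y. P y}" for S
    using that by auto
  from lim show "is_limit {y. Q y} h"
    unfolding is_limit_def by (elim conjE exE, intro conjI exI) (assumption | erule sub)+
qed

inductive_set omega_clone :: "bfun set \<Rightarrow> bfun set" for F where
  base: "h \<in> F \<Longrightarrow> h \<in> omega_clone F"
| EQ: "EQ \<in> omega_clone F"
| add_arg: "h \<in> omega_clone F \<Longrightarrow> i \<le> fst h \<Longrightarrow> add_arg i h \<in> omega_clone F"
| permute_args: "h \<in> omega_clone F \<Longrightarrow> \<pi> permutes {..<fst h} \<Longrightarrow> permute_args \<pi> h \<in> omega_clone F"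
| prod: "h \<in> omega_clone F \<Longrightarrow> h' \<in> omega_clone F \<Longrightarrow> fst h = fst h' \<Longrightarrow> prod_bfun h h' \<in> omega_clone F"
| sum_out: "h \<in> omega_clone F \<Longrightarrow> i < fst h \<Longrightarrow> sum_out i h \<in> omega_clone F"
| limit: "is_limit (omega_clone F) h \<Longrightarrow> h \<in> omega_clone F"

definition fourier :: "bfun \<Rightarrow> bool list \<Rightarrow> real" where
  "fourier = (\<lambda>(k, f) x. (1 / 2 ^ k) * (\<Sum>w\<in>cube k. (- 1) ^ hweight (map2 (\<and>) w x) * f w))"

datatype vertex = External nat | Internal nat

definition terminal :: "vertex set set \<Rightarrow> nat \<Rightarrow> vertex set" where
  "terminal E i = (THE e. e \<in> E \<and> External i \<in> e)"

text \<open>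
  The terminals are the \<open>k\<close> distinct variables of the implemented function, so an
  edge between two external vertices, which would identify two of them, is excluded.
\<close>

definition match_circuit :: "nat \<Rightarrow> nat \<Rightarrow> vertex set set \<Rightarrow> (vertex set \<Rightarrow> real) \<Rightarrow> bool" where
  "match_circuit k n E w \<longleftrightarrow>
     k \<le> n \<and>
     (\<forall>e\<in>E. e \<subseteq> External ` {..<k} \<union> Internal ` {..<n} \<and> card e = 2) \<and>
     (\<forall>i<k. \<exists>!e. e \<in> E \<and> External i \<in> e) \<and>
     inj_on (terminal E) {..<k} \<and>
     (\<forall>i<k. w (terminal E i) = 1) \<and>
     (\<forall>e \<in> E - terminal E ` {..<k}. w e > 0)"

definition implements ::
    "nat \<Rightarrow> nat \<Rightarrow> vertex set set \<Rightarrow> (vertex set \<Rightarrow> real) \<Rightarrow> (bool list \<Rightarrow> real) \<Rightarrow> bool" where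
  "implements k n E w f \<longleftrightarrow>
     (\<forall>x\<in>cube k. f x =
        (\<Sum>H | H \<subseteq> E \<and> (\<forall>i<k. terminal E i \<in> H \<longleftrightarrow> x ! i) \<and>
               (\<forall>j<n. \<exists>!e. e \<in> H \<and> Internal j \<in> e).
           \<Prod>e\<in>H. w e))"

definition Match :: "bfun set" where
  "Match = {h \<in> B_all. \<exists>n E w. match_circuit (fst h) n E w \<and> implements (fst h) n E w (fourier h)}"

definition SDP :: "bfun set" where
  "SDP = {h \<in> B_all.
     (\<forall>x\<in>cube (fst h). snd h x = snd h (map Not x)) \<and>
     (\<forall>x\<in>cube (fst h). fourier h x \<ge> 0) \<and>
     (\<forall>x\<in>cube (fst h). odd (hweight x) \<longrightarrow> fourier h x \<le> 0)}"

end

theory Submission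
  imports Defs
begin

text \<open>
  Self-duality means that the Fourier transform vanishes on odd weights. Nonnegativity of the
  Fourier transform is preserved by products, where it becomes a convolution, and by the other
  operations and limits, so the self-dual functions with nonnegative Fourier transform are closed.
  They contain the match-circuit functions: the number of terminals in a matching has the parity
  of the number of internal vertices, and if this is odd then \<open>f \<ge> 0\<close> forces \<open>f = 0\<close>.

  Conversely, a self-dual ternary \<open>f\<close> has Fourier coefficients \<open>c\<^sub>0\<close> at weight 0 and
  \<open>c\<^sub>1, c\<^sub>2, c\<^sub>3\<close> at weight 2. If \<open>c\<^sub>1 + c\<^sub>2 + c\<^sub>3 > 0\<close>, they are the matching sums of
  \<open>K\<^sub>4\<close> with terminals at three vertices, where the edges to the fourth vertex have weights
  \<open>c\<^sub>1, c\<^sub>2, c\<^sub>3\<close> and the others \<open>c\<^sub>0 / (c\<^sub>1 + c\<^sub>2 + c\<^sub>3)\<close>. Otherwise \<open>f\<close> is constant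
  and arises from a circuit without terminals by adding arguments. Limits are not needed.
\<close>

section \<open>Characters and the Fourier transform\<close>

text \<open>The characters of the group (Z/2)^k, symmetric in \<open>w\<close> and
  \<open>x\<close>.\<close>

definition chi :: "bool list \<Rightarrow> bool list \<Rightarrow> real" where
  "chi w x = (- 1) ^ hweight (map2 (\<and>) w x)"

definition xor_list :: "bool list \<Rightarrow> bool list \<Rightarrow> bool list" where
  "xor_list x y = map2 (\<noteq>) x y"

text \<open>The argument at which \<open>sum_out\<close> evaluates. For
  \<open>i \<le> length x\<close>, deleting position \<open>i\<close> as \<open>add_arg\<close> does
  undoes it, so both operations reduce to splitting a cube sum at one coordinate.\<close>

definition insert_nth :: "nat \<Rightarrow> 'a \<Rightarrow> 'a list \<Rightarrow> 'a list" where
  "insert_nth i b x = take i x @ b # drop i x"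

lemma hweight_simps [simp]:
  "hweight [] = 0" "hweight (b # x) = (if b then Suc (hweight x) else hweight x)"
  "hweight (x @ y) = hweight x + hweight y"
  by (auto simp: hweight_def)

lemma hweight_conv_card: "hweight x = card {i. i < length x \<and> x ! i}"
proof (induction x rule: rev_induct)
  case (snoc b x)
  have "{i. i < length (x @ [b]) \<and> (x @ [b]) ! i} =
      {i. i < length x \<and> x ! i} \<union> (if b then {length x} else {})"
    by (auto simp: nth_append less_Suc_eq)
  then show ?case
    using snoc by simp
qed simp

lemma finite_cube [simp]: "finite (cube k)"
  using finite_lists_length_eq [of "UNIV :: bool set" k] by (simp add: cube_def)

lemma cube_0: "cube 0 = {[]}"
  by (auto simp: cube_def)

lemma cube_nonempty [simp]: "cube k \<noteq> {}"
  using length_replicate [of k True] unfolding cube_def by blast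

lemma map_Not_in_cube [simp]: "map Not x \<in> cube k \<longleftrightarrow> x \<in> cube k"
  by (simp add: cube_def)

lemma chi_Nil [simp]: "chi [] x = 1"
  by (simp add: chi_def)

lemma chi_Cons [simp]: "chi (a # w) (b # x) = (if a \<and> b then - chi w x else chi w x)"
  by (simp add: chi_def)

lemma chi_append: "length u = length y \<Longrightarrow> chi (u @ v) (y @ z) = chi u y * chi v z"
  by (simp add: chi_def power_add)

text \<open>Characters are multiplicative over concatenation, so the inserted position contributes
  one sign of its own.\<close>

lemma chi_insert_nth:
  assumes "length w = length x"
  shows "chi (insert_nth i a w) (insert_nth i b x) = (if a \<and> b then - chi w x else chi w x)"
proof -
  have "chi w x = chi (take i w) (take i x) * chi (drop i w) (drop i x)"
    using assms by (simp flip: chi_append)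
  then show ?thesis
    using assms by (simp add: insert_nth_def chi_append)
qed

lemma chi_xor_list:
  assumes "length w = length x" "length w = length y"
  shows "chi w (xor_list x y) = chi w x * chi w y"
proof -
  have "length x = length y"
    using assms by simp
  with assms(1) show ?thesis
    by (induction w x y rule: list_induct3) (auto simp: xor_list_def)
qed

text \<open>Each position at which \<open>x\<close> is 1 contributes a change of sign. This ties
  complement symmetry to the parity of Hamming weights.\<close>

lemma chi_map_Not:
  "length w = length x \<Longrightarrow> chi (map Not w) x = (- 1) ^ hweight x * chi w x"
  by (induction w x rule: list_induct2) auto

text \<open>Permuting both lists permutes their positionwise conjunction, whose weight depends only
  on its multiset.\<close>

lemma chi_permute_list:
  assumes "\<pi> permutes {..<k}" "length w = k" "length x = k"
  shows "chi (permute_list \<pi> w) (permute_list \<pi> x) = chi w x"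
proof -
  have "map2 (\<and>) (permute_list \<pi> w) (permute_list \<pi> x) = permute_list \<pi> (map2 (\<and>) w x)"
    using assms by (simp add: permute_list_map permute_list_zip)
  moreover have "mset (permute_list \<pi> (map2 (\<and>) w x)) = mset (map2 (\<and>) w x)"
    using assms by (intro mset_permute_list) simp
  ultimately show ?thesis
    by (simp add: chi_def hweight_def flip: count_mset)
qed

section \<open>Sums over the cube, one coordinate at a time\<close>

lemma bij_betw_insert_nth:
  assumes "i \<le> k"
  shows "bij_betw (\<lambda>(b, w). insert_nth i b w) (UNIV \<times> cube k) (cube (Suc k))"
  by (rule bij_betw_byWitness [where f' = "\<lambda>v. (v ! i, take i v @ drop (Suc i) v)"])
    (use assms in \<open>auto simp: cube_def insert_nth_def nth_append min_def id_take_nth_drop [symmetric]\<close>)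

lemma sum_cube_Suc:
  fixes g :: "bool list \<Rightarrow> real"
  assumes "i \<le> k"
  shows "(\<Sum>v\<in>cube (Suc k). g v) = (\<Sum>w\<in>cube k. \<Sum>b\<in>UNIV. g (insert_nth i b w))"
proof -
  have "(\<Sum>v\<in>cube (Suc k). g v) = (\<Sum>(b, w)\<in>UNIV \<times> cube k. g (insert_nth i b w))"
    using sum.reindex_bij_betw [OF bij_betw_insert_nth [OF assms], of g]
    by (simp add: case_prod_unfold)
  also have "\<dots> = (\<Sum>w\<in>cube k. \<Sum>b\<in>UNIV. g (insert_nth i b w))"
    by (subst sum.swap) (simp add: sum.cartesian_product)
  finally show ?thesis .
qed

lemma cube_Suc_cases:
  assumes "x \<in> cube (Suc k)" "i \<le> k"
  obtains b y where "x = insert_nth i b y" "y \<in> cube k"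
  using bij_betw_imp_surj_on [OF bij_betw_insert_nth [OF assms(2)]] assms(1) by force

text \<open>Splitting off the first coordinate leaves a factor 1 + 1 if the heads of
  \<open>x\<close> and \<open>y\<close> agree and 1 - 1 otherwise.\<close>

lemma chi_orthogonal:
  assumes "x \<in> cube k" "y \<in> cube k"
  shows "(\<Sum>z\<in>cube k. chi x z * chi y z) = (if x = y then 2 ^ k else 0)"
  using assms
proof (induction k arbitrary: x y)
  case 0
  then show ?case
    by (simp add: cube_0)
next
  case (Suc k)
  obtain a x' b y' where *: "x = a # x'" "y = b # y'" "x' \<in> cube k" "y' \<in> cube k"
    using Suc.prems by (auto simp: cube_def length_Suc_conv)
  have "(\<Sum>z\<in>cube (Suc k). chi x z * chi y z) =
      (if a = b then 2 else 0) * (\<Sum>z\<in>cube k. chi x' z * chi y' z)"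
    by (subst sum_cube_Suc [of 0])
      (auto simp: * insert_nth_def UNIV_bool sum_distrib_left intro!: sum.cong sum.neutral)
  then show ?case
    using Suc.IH [of x' y'] * by simp
qed

section \<open>Fourier inversion, convolution and parity\<close>

lemma fourier_conv_chi: "fourier (k, f) x = (\<Sum>w\<in>cube k. chi w x * f w) / 2 ^ k"
  by (simp add: fourier_def chi_def)

text \<open>By \<open>chi_orthogonal\<close> only the term of \<open>w\<close> survives, and its
  factor \<open>2 ^ k\<close> cancels the normalisation of \<open>fourier\<close>.\<close>

lemma fourier_inversion:
  assumes "w \<in> cube k"
  shows "f w = (\<Sum>x\<in>cube k. fourier (k, f) x * chi w x)"
proof -
  have "(\<Sum>x\<in>cube k. fourier (k, f) x * chi w x) =
      (\<Sum>x\<in>cube k. \<Sum>v\<in>cube k. f v * (chi v x * chi w x)) / 2 ^ k"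
    by (simp add: fourier_conv_chi sum_divide_distrib sum_distrib_left sum_distrib_right mult_ac)
  also have "\<dots> = (\<Sum>v\<in>cube k. f v * (\<Sum>x\<in>cube k. chi v x * chi w x)) / 2 ^ k"
    by (subst sum.swap) (simp add: sum_distrib_left)
  also have "\<dots> = (\<Sum>v\<in>cube k. if v = w then f v * 2 ^ k else 0) / 2 ^ k"
    using assms by (intro arg_cong2 [where f = "(/)"] sum.cong) (auto simp: chi_orthogonal)
  also have "\<dots> = f w"
    using assms by simp
  finally show ?thesis ..
qed

lemma fourier_cong:
  "(\<And>w. w \<in> cube k \<Longrightarrow> f w = g w) \<Longrightarrow> fourier (k, f) x = fourier (k, g) x"
  by (simp add: fourier_conv_chi)

lemma fourier_restrict [simp]: "fourier (k, restrict f (cube k)) = fourier (k, f)"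
  by (intro ext fourier_cong) simp

lemma fourier_mult:
  assumes "x \<in> cube k"
  shows "fourier (k, \<lambda>w. f w * g w) x =
    (\<Sum>y\<in>cube k. fourier (k, f) y * fourier (k, g) (xor_list x y))"
proof -
  have "(\<Sum>w\<in>cube k. chi w x * (f w * g w)) =
      (\<Sum>w\<in>cube k. chi w x * ((\<Sum>y\<in>cube k. fourier (k, f) y * chi w y) * g w))"
    \<comment> \<open>Only \<open>f\<close> is expanded. Its characters merge with
      \<open>chi w x\<close> into \<open>chi w (xor_list x y)\<close>, which leaves a transform of
      \<open>g\<close>.\<close>
    by (rule sum.cong [OF refl]) (simp flip: fourier_inversion)
  also have "\<dots> = (\<Sum>w\<in>cube k. \<Sum>y\<in>cube k. fourier (k, f) y * (chi w (xor_list x y) * g w))"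
    using assms
    by (intro sum.cong refl) (auto simp: cube_def chi_xor_list sum_distrib_left sum_distrib_right mult_ac)
  also have "\<dots> = (\<Sum>y\<in>cube k. fourier (k, f) y * (\<Sum>w\<in>cube k. chi w (xor_list x y) * g w))"
    by (subst sum.swap) (simp add: sum_distrib_left)
  finally show ?thesis
    by (simp add: fourier_conv_chi [of k "\<lambda>w. f w * g w"] fourier_conv_chi [of k g] flip: sum_divide_distrib)
qed

text \<open>Reindexing by complementation shows that the sum equals its own negative.\<close>

lemma fourier_self_dual:
  assumes "\<And>w. w \<in> cube k \<Longrightarrow> f (map Not w) = f w" "x \<in> cube k" "odd (hweight x)"
  shows "fourier (k, f) x = 0"
proof -
  have "bij_betw (map Not) (cube k) (cube k)"
    by (rule bij_betw_byWitness [where f' = "map Not"]) (auto simp: cube_def o_def)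
  then have "(\<Sum>w\<in>cube k. chi w x * f w) = (\<Sum>w\<in>cube k. chi (map Not w) x * f (map Not w))"
    by (rule sum.reindex_bij_betw [symmetric])
  also have "\<dots> = (\<Sum>w\<in>cube k. - (chi w x * f w))"
    using assms by (intro sum.cong refl) (auto simp: cube_def chi_map_Not)
  finally show ?thesis
    by (simp add: fourier_conv_chi sum_negf)
qed

section \<open>Closure of the self-dual functions with nonnegative Fourier transform\<close>

text \<open>The inequality at odd weights follows from self-duality through
  \<open>fourier_self_dual\<close>.\<close>

lemma SDP_iff:
  "(k, f) \<in> SDP \<longleftrightarrow> f \<in> cube k \<rightarrow>\<^sub>E {0..} \<and> (\<forall>x\<in>cube k. f (map Not x) = f x) \<and>
     (\<forall>x\<in>cube k. fourier (k, f) x \<ge> 0)"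
  by (simp add: SDP_def B_all_def B_arity_def) (metis fourier_self_dual order_refl)

text \<open>The transform is 1/2 at weights 0 and 2, and 0 at weight 1.\<close>

lemma SDP_EQ: "EQ \<in> SDP"
proof -
  have cube2: "cube 2 = {[False, False], [False, True], [True, False], [True, True]}"
    by (auto simp: cube_def numeral_2_eq_2 length_Suc_conv)
  show ?thesis
    unfolding EQ_def SDP_iff by (auto simp: cube2 fourier_conv_chi)
qed

text \<open>The new transform is the old one where the added coordinate is 0, and vanishes where it
  is 1.\<close>

lemma SDP_add_arg:
  assumes "(k, f) \<in> SDP" "i \<le> k"
  shows "add_arg i (k, f) \<in> SDP"
proof -
  let ?f = "\<lambda>x. f (take i x @ drop (Suc i) x)"
  have f: "f \<in> cube k \<rightarrow>\<^sub>E {0..}" "\<And>x. x \<in> cube k \<Longrightarrow> f (map Not x) = f x"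
    "\<And>x. x \<in> cube k \<Longrightarrow> fourier (k, f) x \<ge> 0"
    using assms by (auto simp: SDP_iff)
  have del: "take i x @ drop (Suc i) x \<in> cube k" if "x \<in> cube (Suc k)" for x :: "bool list"
    using that assms(2) by (auto simp: cube_def)
  have "?f (map Not x) = ?f x" if "x \<in> cube (Suc k)" for x
    using f(2) [OF del [OF that]] by (simp add: take_map drop_map)
  moreover have "fourier (Suc k, ?f) x \<ge> 0" if x: "x \<in> cube (Suc k)" for x
  proof -
    obtain b y where y: "x = insert_nth i b y" "y \<in> cube k"
      using cube_Suc_cases [OF x assms(2)] .
    have "?f (insert_nth i a w) = f w" if "w \<in> cube k" for a w
      using that assms(2) by (simp add: insert_nth_def cube_def min_def)
    then have "(\<Sum>v\<in>cube (Suc k). chi v x * ?f v) =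
        (\<Sum>w\<in>cube k. \<Sum>a\<in>UNIV. chi (insert_nth i a w) x * f w)"
      by (simp add: sum_cube_Suc [OF assms(2)])
    also have "\<dots> = (\<Sum>w\<in>cube k. (if b then 0 else 2) * (chi w y * f w))"
      using y(2) by (intro sum.cong refl) (auto simp: y(1) cube_def UNIV_bool chi_insert_nth)
    also have "\<dots> = (if b then 0 else 2) * (2 ^ k * fourier (k, f) y)"
      by (simp add: fourier_conv_chi flip: sum_distrib_left)
    finally show ?thesis
      using f(3) [OF y(2)] by (simp add: fourier_conv_chi [of "Suc k"])
  qed
  moreover have "restrict ?f (cube (Suc k)) \<in> cube (Suc k) \<rightarrow>\<^sub>E {0..}"
    using f(1) del by auto
  ultimately show ?thesis
    by (auto simp: add_arg_def SDP_iff)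
qed

text \<open>As \<open>chi\<close> is invariant under permuting both of its arguments, the transform
  is permuted in the same way as \<open>f\<close>.\<close>

lemma SDP_permute_args:
  assumes "(k, f) \<in> SDP" "\<pi> permutes {..<k}"
  shows "permute_args \<pi> (k, f) \<in> SDP"
proof -
  let ?f = "\<lambda>x. f (permute_list \<pi> x)"
  have f: "f \<in> cube k \<rightarrow>\<^sub>E {0..}" "\<And>x. x \<in> cube k \<Longrightarrow> f (map Not x) = f x"
    "\<And>x. x \<in> cube k \<Longrightarrow> fourier (k, f) x \<ge> 0"
    using assms by (auto simp: SDP_iff)
  have perm: "permute_list \<pi> x \<in> cube k" if "x \<in> cube k" for x :: "bool list"
    using that by (auto simp: cube_def)
  have "inj_on (permute_list \<pi>) (cube k)"
  proof (rule inj_on_inverseI [where g = "permute_list (inv \<pi>)"])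
    fix x :: "bool list"
    assume "x \<in> cube k"
    then show "permute_list (inv \<pi>) (permute_list \<pi> x) = x"
      using assms(2) by (simp add: cube_def permutes_inv permutes_inv_o flip: permute_list_compose)
  qed
  then have bij: "bij_betw (permute_list \<pi>) (cube k) (cube k)"
    using perm endo_inj_surj [OF finite_cube, of "permute_list \<pi>" k]
    by (auto simp: bij_betw_def)
  have "?f (map Not x) = ?f x" if "x \<in> cube k" for x
    using f(2) [OF perm [OF that]] that assms(2) by (simp add: permute_list_map cube_def)
  moreover have "fourier (k, ?f) x \<ge> 0" if x: "x \<in> cube k" for x
  proof -
    have "(\<Sum>w\<in>cube k. chi w x * ?f w) =
        (\<Sum>w\<in>cube k. chi (permute_list \<pi> w) (permute_list \<pi> x) * ?f w)"
      using x assms(2) by (intro sum.cong refl) (simp add: cube_def chi_permute_list)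
    also have "\<dots> = (\<Sum>w\<in>cube k. chi w (permute_list \<pi> x) * f w)"
      by (rule sum.reindex_bij_betw [OF bij])
    finally show ?thesis
      using f(3) [OF perm [OF x]] by (simp add: fourier_conv_chi)
  qed
  moreover have "restrict ?f (cube k) \<in> cube k \<rightarrow>\<^sub>E {0..}"
    using f(1) perm by auto
  ultimately show ?thesis
    by (auto simp: permute_args_def SDP_iff)
qed

lemma SDP_prod:
  assumes "(k, f) \<in> SDP" "(k, g) \<in> SDP"
  shows "prod_bfun (k, f) (k, g) \<in> SDP"
proof -
  have *: "f \<in> cube k \<rightarrow>\<^sub>E {0..}" "g \<in> cube k \<rightarrow>\<^sub>E {0..}"
    "\<forall>x\<in>cube k. f (map Not x) = f x" "\<forall>x\<in>cube k. g (map Not x) = g x"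
    "\<And>x. x \<in> cube k \<Longrightarrow> fourier (k, f) x \<ge> 0" "\<And>x. x \<in> cube k \<Longrightarrow> fourier (k, g) x \<ge> 0"
    using assms by (auto simp: SDP_iff)
  have "fourier (k, \<lambda>x. f x * g x) x \<ge> 0" if "x \<in> cube k" for x
    using that unfolding fourier_mult [OF that]
    by (intro sum_nonneg mult_nonneg_nonneg *) (auto simp: cube_def xor_list_def)
  moreover have "(\<lambda>x\<in>cube k. f x * g x) \<in> cube k \<rightarrow>\<^sub>E {0..}"
    using *(1,2) by (auto simp: PiE_iff)
  ultimately show ?thesis
    using *(3,4) by (auto simp: prod_bfun_def SDP_iff)
qed

text \<open>The new transform at \<open>x\<close> is twice the old one at \<open>x\<close> with 0
  inserted at position \<open>i\<close>.\<close>

lemma SDP_sum_out: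
  assumes "(k, f) \<in> SDP" "i < k"
  shows "sum_out i (k, f) \<in> SDP"
proof -
  obtain m where m: "k = Suc m" "i \<le> m"
    using assms(2) by (cases k) auto
  let ?f = "\<lambda>x. \<Sum>b\<in>UNIV. f (insert_nth i b x)"
  have f: "f \<in> cube k \<rightarrow>\<^sub>E {0..}" "\<And>x. x \<in> cube k \<Longrightarrow> f (map Not x) = f x"
    "\<And>x. x \<in> cube k \<Longrightarrow> fourier (k, f) x \<ge> 0"
    using assms by (auto simp: SDP_iff)
  have ins: "insert_nth i b x \<in> cube k" if "x \<in> cube m" for x b
    using that m by (auto simp: cube_def insert_nth_def)
  \<comment> \<open>Complementation exchanges the two summands.\<close>
  have "?f (map Not x) = ?f x" if "x \<in> cube m" for x
    using f(2) [OF ins [OF that, of True]] f(2) [OF ins [OF that, of False]]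
    by (simp add: UNIV_bool insert_nth_def take_map drop_map)
  moreover have "fourier (m, ?f) x \<ge> 0" if x: "x \<in> cube m" for x
  proof -
    \<comment> \<open>Inserting \<open>False\<close> into \<open>x\<close> makes the character
      independent of the summed bit.\<close>
    have "(\<Sum>w\<in>cube m. chi w x * ?f w) =
        (\<Sum>w\<in>cube m. \<Sum>b\<in>UNIV. chi (insert_nth i b w) (insert_nth i False x) * f (insert_nth i b w))"
      using x by (intro sum.cong refl) (simp add: cube_def chi_insert_nth sum_distrib_left)
    also have "\<dots> = (\<Sum>v\<in>cube k. chi v (insert_nth i False x) * f v)"
      by (simp add: m sum_cube_Suc [OF m(2)])
    also have "\<dots> = 2 ^ k * fourier (k, f) (insert_nth i False x)"
      by (simp add: fourier_conv_chi)
    finally show ?thesis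
      using f(3) [OF ins [OF x]] by (simp add: fourier_conv_chi [of m])
  qed
  moreover have "restrict ?f (cube m) \<in> cube m \<rightarrow>\<^sub>E {0..}"
    using f(1) ins by (auto simp: PiE_iff intro!: sum_nonneg)
  ultimately show ?thesis
    by (auto simp: sum_out_def SDP_iff m(1) insert_nth_def)
qed

section \<open>Generated closures and limits\<close>

lemma clone_subset_SDP:
  assumes "S \<subseteq> SDP"
  shows "clone S \<subseteq> SDP"
proof
  fix h
  assume "h \<in> clone S"
  then show "h \<in> SDP"
  proof induction
    case (prod h h')
    then show ?case
      by (metis SDP_prod prod.collapse)
  qed (use assms in \<open>auto intro: SDP_EQ SDP_add_arg SDP_permute_args SDP_sum_out\<close>)
qed

text \<open>The approximants lie in \<open>SDP\<close> by \<open>clone_subset_SDP\<close>. The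
  transform is a finite sum, hence continuous, and equations and weak inequalities survive pointwise
  limits.\<close>

lemma SDP_limit:
  assumes "is_limit SDP h"
  shows "h \<in> SDP"
proof -
  obtain k f where h: "h = (k, f)"
    by fastforce
  obtain S where S: "S \<subseteq> SDP"
    and approx: "\<And>\<epsilon>. \<epsilon> > 0 \<Longrightarrow> \<exists>g\<in>clone S. fst g = k \<and> (MAX x\<in>cube k. \<bar>f x - snd g x\<bar>) < \<epsilon>"
    using assms by (auto simp: is_limit_def h)
  have "\<exists>g. (k, g) \<in> SDP \<and> (\<forall>x\<in>cube k. \<bar>g x - f x\<bar> < 1 / Suc n)" for n
  proof -
    obtain g where "(k, g) \<in> clone S" "(MAX x\<in>cube k. \<bar>f x - g x\<bar>) < 1 / Suc n"
      using approx [of "1 / Suc n"] by force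
    then show ?thesis
      using clone_subset_SDP [OF S] by (force simp: abs_minus_commute)
  qed
  then obtain g where g: "\<And>n. (k, g n) \<in> SDP"
      "\<And>n x. x \<in> cube k \<Longrightarrow> \<bar>g n x - f x\<bar> < 1 / Suc n"
    by metis
  have lim: "(\<lambda>n. g n x) \<longlonglongrightarrow> f x" if "x \<in> cube k" for x
  proof -
    have "(\<lambda>n. g n x - f x) \<longlonglongrightarrow> 0"
      using g(2) [OF that] by (intro LIMSEQ_norm_0) simp
    then show ?thesis
      by (simp add: LIM_zero_iff)
  qed
  have "f (map Not x) = f x" if x: "x \<in> cube k" for x
  proof -
    have "(\<lambda>n. g n (map Not x)) = (\<lambda>n. g n x)"
      using g(1) x by (auto simp: SDP_iff)
    then show ?thesis
      using LIMSEQ_unique [OF lim [OF x]] lim [of "map Not x"] x by (simp add: cube_def)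
  qed
  moreover have "fourier (k, f) x \<ge> 0" if x: "x \<in> cube k" for x
  proof (rule LIMSEQ_le_const)
    show "(\<lambda>n. fourier (k, g n) x) \<longlonglongrightarrow> fourier (k, f) x"
      unfolding fourier_conv_chi by (intro tendsto_intros lim) auto
    show "\<exists>N. \<forall>n\<ge>N. 0 \<le> fourier (k, g n) x"
      using g(1) x by (auto simp: SDP_iff)
  qed
  \<comment> \<open>Nonnegativity of \<open>f\<close> itself is part of
    \<open>is_limit\<close>.\<close>
  moreover have "f \<in> cube k \<rightarrow>\<^sub>E {0..}"
    using assms by (auto simp: is_limit_def h B_all_def B_arity_def)
  ultimately show ?thesis
    by (auto simp: h SDP_iff)
qed

lemma omega_clone_subset_SDP:
  assumes "F \<subseteq> SDP"
  shows "omega_clone F \<subseteq> SDP"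
proof
  fix h
  assume "h \<in> omega_clone F"
  then show "h \<in> SDP"
  proof induction
    case (prod h h')
    then show ?case
      by (metis SDP_prod prod.collapse)
  next
    case (limit h)
    \<comment> \<open>By the induction hypothesis the finite set witnessing the limit already lies
      in \<open>SDP\<close>.\<close>
    then have "is_limit SDP h"
      unfolding is_limit_def by blast
    then show ?case
      by (rule SDP_limit)
  qed (use assms in \<open>auto intro: SDP_EQ SDP_add_arg SDP_permute_args SDP_sum_out\<close>)
qed

section \<open>Match-circuits\<close>

definition matchings :: "nat \<Rightarrow> nat \<Rightarrow> vertex set set \<Rightarrow> bool list \<Rightarrow> vertex set set set" where
  "matchings k n E x = {H. H \<subseteq> E \<and> (\<forall>i<k. terminal E i \<in> H \<longleftrightarrow> x ! i) \<and>
     (\<forall>j<n. \<exists>!e. e \<in> H \<and> Internal j \<in> e)}"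

lemma implements_iff:
  "implements k n E w f \<longleftrightarrow> (\<forall>x\<in>cube k. f x = (\<Sum>H\<in>matchings k n E x. \<Prod>e\<in>H. w e))"
  by (simp add: implements_def matchings_def)

lemma match_circuit_finite: "match_circuit k n E w \<Longrightarrow> finite E"
  by (rule finite_subset [where B = "Pow (External ` {..<k} \<union> Internal ` {..<n})"])
    (auto simp: match_circuit_def)

lemma terminal_props:
  assumes "match_circuit k n E w" "i < k"
  shows "terminal E i \<in> E" "External i \<in> terminal E i"
    "e \<in> E \<Longrightarrow> External i \<in> e \<Longrightarrow> e = terminal E i"
proof -
  have *: "\<exists>!e. e \<in> E \<and> External i \<in> e"
    using assms by (auto simp: match_circuit_def)
  from theI' [OF this] show "terminal E i \<in> E" "External i \<in> terminal E i"
    by (auto simp: terminal_def)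
  with * show "e \<in> E \<Longrightarrow> External i \<in> e \<Longrightarrow> e = terminal E i"
    by blast
qed

text \<open>
  Counting the internal endpoints of the edges of a matching: a terminal has one
  of them, every other edge has two.
\<close>

lemma matching_parity:
  assumes mc: "match_circuit k n E w" and x: "x \<in> cube k" and H: "H \<in> matchings k n E x"
  shows "even n \<longleftrightarrow> even (hweight x)"
proof -
  let ?T = "terminal E ` {..<k}"
  let ?I = "Internal ` {..<n}"
  have HE: "H \<subseteq> E" and term_iff: "\<And>i. i < k \<Longrightarrow> terminal E i \<in> H \<longleftrightarrow> x ! i"
    and once: "\<And>j. j < n \<Longrightarrow> \<exists>!e. e \<in> H \<and> Internal j \<in> e"
    using H by (auto simp: matchings_def)
  have fin: "finite H"
    using HE match_circuit_finite [OF mc] by (rule finite_subset)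
  have edge: "e \<subseteq> External ` {..<k} \<union> ?I" "card e = 2" if "e \<in> H" for e
    using mc HE that by (auto simp: match_circuit_def)
  have inj: "inj_on (terminal E) {..<k}"
    using mc by (simp add: match_circuit_def)
  have card_nonterminal: "card (e \<inter> ?I) = 2" if "e \<in> H - ?T" for e
  proof -
    \<comment> \<open>The only edge at an external vertex is its terminal, so both ends of
      \<open>e\<close> are internal.\<close>
    have "External i \<notin> e" if "i < k" for i
      using terminal_props(3) [OF mc that] \<open>e \<in> H - ?T\<close> HE \<open>i < k\<close> by auto
    then have "e \<inter> ?I = e"
      using edge(1) [of e] that by blast
    then show ?thesis
      using edge(2) that by simp
  qed
  have card_terminal: "card (e \<inter> ?I) = 1" if e: "e \<in> H \<inter> ?T" for e
  proof -
    obtain i where i: "i < k" "e = terminal E i"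
      using e by auto
    \<comment> \<open>An edge with two external ends would be the terminal of both, contrary to
      injectivity.\<close>
    have "External j \<notin> e" if "j < k" "j \<noteq> i" for j
      using terminal_props(3) [OF mc that(1), of e] e HE inj i that by (auto simp: inj_on_def)
    then have "e \<inter> ?I = e - {External i}"
      using edge(1) [of e] e by blast
    then show ?thesis
      using edge(2) [of e] e terminal_props(2) [OF mc i(1)] i(2) by simp
  qed
  have "n = (\<Sum>j<n. card {e \<in> H. Internal j \<in> e})"
  proof -
    have "card {e \<in> H. Internal j \<in> e} = 1" if "j < n" for j
      using once [OF that] by (auto simp: card_1_singleton_iff)
    then show ?thesis
      by simp
  qed
  also have "\<dots> = (\<Sum>e\<in>H. card {j \<in> {..<n}. Internal j \<in> e})"
    using fin by (intro sum_multicount_gen [symmetric]) auto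
  also have "\<dots> = (\<Sum>e\<in>H. card (e \<inter> ?I))"
  proof (rule sum.cong [OF refl])
    fix e
    have "e \<inter> ?I = Internal ` {j \<in> {..<n}. Internal j \<in> e}"
      by auto
    then show "card {j \<in> {..<n}. Internal j \<in> e} = card (e \<inter> ?I)"
      by (simp add: card_image inj_on_def)
  qed
  also have "\<dots> = card (H \<inter> ?T) + 2 * card (H - ?T)"
    using sum.Int_Diff [OF fin, of "\<lambda>e. card (e \<inter> ?I)" ?T]
    by (simp add: card_nonterminal card_terminal)
  also have "H \<inter> ?T = terminal E ` {i. i < k \<and> x ! i}"
    using term_iff by auto
  also have "card \<dots> = hweight x"
    using x inj by (simp add: hweight_conv_card cube_def card_image inj_on_def)
  finally show ?thesis
    by simp
qed

lemma matching_weight_nonneg: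
  assumes "match_circuit k n E w" "H \<in> matchings k n E x"
  shows "(\<Prod>e\<in>H. w e) \<ge> 0"
proof (rule prod_nonneg)
  fix e
  assume "e \<in> H"
  then have "e \<in> E"
    using assms(2) by (auto simp: matchings_def)
  then show "w e \<ge> 0"
    using assms(1) by (cases "e \<in> terminal E ` {..<k}") (auto simp: match_circuit_def less_imp_le)
qed

text \<open>
  If \<open>n\<close> is odd then the Fourier transform lives on odd weights, so \<open>f\<close> changes sign
  under complementation and vanishes.
\<close>

lemma Match_subset_SDP: "Match \<subseteq> SDP"
proof
  fix h
  assume "h \<in> Match"
  then obtain k f n E w where h: "h = (k, f)" "(k, f) \<in> B_all"
    and mc: "match_circuit k n E w" and impl: "implements k n E w (fourier (k, f))"
    by (cases h) (auto simp: Match_def)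
  have f: "f \<in> cube k \<rightarrow>\<^sub>E {0..}"
    using h(2) by (auto simp: B_all_def B_arity_def)
  have nonneg: "fourier (k, f) x \<ge> 0" if "x \<in> cube k" for x
    using impl that matching_weight_nonneg [OF mc] by (auto simp: implements_iff intro: sum_nonneg)
  have zero: "fourier (k, f) x = 0" if "x \<in> cube k" "even n \<noteq> even (hweight x)" for x
  proof -
    have "matchings k n E x = {}"
      using matching_parity [OF mc that(1)] that(2) by blast
    then show ?thesis
      using impl that(1) by (simp add: implements_iff)
  qed
  have compl: "f (map Not v) = (- 1) ^ n * f v" if v: "v \<in> cube k" for v
  proof -
    have "f (map Not v) = (\<Sum>x\<in>cube k. fourier (k, f) x * chi (map Not v) x)"
      using v by (intro fourier_inversion) simp
    \<comment> \<open>By \<open>zero\<close> only weights of the parity of \<open>n\<close> survive,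
      and there the sign from \<open>chi_map_Not\<close> is \<open>(- 1) ^ n\<close>.\<close>
    also have "\<dots> = (\<Sum>x\<in>cube k. (- 1) ^ n * (fourier (k, f) x * chi v x))"
    proof (rule sum.cong [OF refl])
      fix x
      assume x: "x \<in> cube k"
      show "fourier (k, f) x * chi (map Not v) x = (- 1) ^ n * (fourier (k, f) x * chi v x)"
        using zero [OF x] x v by (cases "even n = even (hweight x)") (auto simp: cube_def chi_map_Not)
    qed
    also have "\<dots> = (- 1) ^ n * f v"
      using fourier_inversion [OF v, of f] by (simp add: sum_distrib_left)
    finally show ?thesis .
  qed
  have "f (map Not v) = f v" if v: "v \<in> cube k" for v
  proof (cases "even n")
    case False
    have "f v \<ge> 0" "f (map Not v) \<ge> 0"
      using f v by (auto simp: PiE_iff)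
    then show ?thesis
      using compl [OF v] False by simp
  qed (use compl [OF v] in simp)
  then show "h \<in> SDP"
    using f nonneg by (auto simp: h(1) SDP_iff)
qed

text \<open>An edge set containing an edge of weight 0 has product 0, so deleting such edges leaves
  the sum unchanged.\<close>

lemma sum_prod_prune:
  fixes w :: "'a \<Rightarrow> real"
  assumes "finite E" "\<And>e. e \<in> E \<Longrightarrow> w e \<ge> 0"
  shows "(\<Sum>H | H \<subseteq> {e \<in> E. w e > 0} \<and> P H. \<Prod>e\<in>H. w e) =
    (\<Sum>H | H \<subseteq> E \<and> P H. \<Prod>e\<in>H. w e)"
proof (rule sum.mono_neutral_left)
  show "\<forall>H\<in>{H. H \<subseteq> E \<and> P H} - {H. H \<subseteq> {e \<in> E. w e > 0} \<and> P H}. (\<Prod>e\<in>H. w e) = 0"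
  proof
    fix H
    assume "H \<in> {H. H \<subseteq> E \<and> P H} - {H. H \<subseteq> {e \<in> E. w e > 0} \<and> P H}"
    then obtain e where "H \<subseteq> E" "e \<in> H" "\<not> w e > 0"
      by auto
    then have "finite H" "w e = 0"
      using assms finite_subset by (blast, force)
    then show "(\<Prod>e\<in>H. w e) = 0"
      using \<open>e \<in> H\<close> by auto
  qed
qed (use assms(1) in auto)

text \<open>Edges of weight 0 are admitted here, although match-circuits must leave them out.\<close>

lemma Match_intro:
  fixes k n :: nat and w :: "vertex set \<Rightarrow> real"
  defines "T \<equiv> (\<lambda>i. {External i, Internal i}) ` {..<k}"
  assumes f: "(k, f) \<in> B_all" and kn: "k \<le> n"
    and F: "\<And>e. e \<in> F \<Longrightarrow> e \<subseteq> Internal ` {..<n} \<and> card e = 2 \<and> w e \<ge> 0"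
    and T: "\<And>e. e \<in> T \<Longrightarrow> w e = 1"
    and fourier: "\<And>x. x \<in> cube k \<Longrightarrow> even n = even (hweight x) \<Longrightarrow>
      fourier (k, f) x = (\<Sum>H | H \<subseteq> T \<union> F \<and> (\<forall>i<k. {External i, Internal i} \<in> H \<longleftrightarrow> x ! i) \<and>
        (\<forall>j<n. \<exists>!e. e \<in> H \<and> Internal j \<in> e). \<Prod>e\<in>H. w e)"
    and fourier_0: "\<And>x. x \<in> cube k \<Longrightarrow> even n \<noteq> even (hweight x) \<Longrightarrow> fourier (k, f) x = 0"
  shows "(k, f) \<in> Match"
proof -
  define E where "E = {e \<in> T \<union> F. w e > 0}"
  have "F \<subseteq> Pow (Internal ` {..<n})"
    using F by blast
  then have fin: "finite (T \<union> F)"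
    by (auto simp: T_def intro: finite_subset)
  \<comment> \<open>Terminals have weight 1 and survive the pruning, and edges of \<open>F\<close>
    touch no external vertex.\<close>
  have ext: "e \<in> E \<and> External i \<in> e \<longleftrightarrow> e = {External i, Internal i}" if "i < k" for e i
    using F T that by (fastforce simp: E_def T_def)
  have terminal: "terminal E i = {External i, Internal i}" if "i < k" for i
    unfolding terminal_def ext [OF that] by simp
  have "inj_on (terminal E) {..<k}"
    by (auto simp: inj_on_def terminal doubleton_eq_iff)
  moreover have "e \<subseteq> External ` {..<k} \<union> Internal ` {..<n} \<and> card e = 2" if "e \<in> E" for e
    using that F kn by (auto simp: E_def T_def)
  ultimately have mc: "match_circuit k n E w"
    using kn T by (auto simp: match_circuit_def terminal ext T_def) (auto simp: E_def)
  have "fourier (k, f) x = (\<Sum>H\<in>matchings k n E x. \<Prod>e\<in>H. w e)" if x: "x \<in> cube k" for x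
  proof (cases "even n = even (hweight x)")
    case True
    have "matchings k n E x = {H. H \<subseteq> E \<and> (\<forall>i<k. {External i, Internal i} \<in> H \<longleftrightarrow> x ! i) \<and>
        (\<forall>j<n. \<exists>!e. e \<in> H \<and> Internal j \<in> e)}"
      by (auto simp: matchings_def terminal)
    moreover have "w e \<ge> 0" if "e \<in> T \<union> F" for e
      using F T that by fastforce
    ultimately show ?thesis
      unfolding fourier [OF x True] using sum_prod_prune [OF fin, of w]
      by (simp only: E_def)
  next
    case False
    \<comment> \<open>At the wrong parity both sides are 0, the sum because it is empty.\<close>
    then have "matchings k n E x = {}"
      using matching_parity [OF mc x] by blast
    then show ?thesis
      using fourier_0 [OF x False] by simp
  qed
  then show ?thesis
    using f mc by (auto simp: Match_def implements_iff)
qed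

section \<open>Functions of arity three\<close>

text \<open>Peeling off one edge at a time turns the condition at a vertex into a propositional
  formula: either \<open>a\<close> is the chosen edge and excludes the rest, or the choice lies in
  \<open>S\<close>.\<close>

lemma ex1_mem_insert:
  assumes "a \<notin> S"
  shows "(\<exists>!e. e \<in> H \<and> e \<in> insert a S) \<longleftrightarrow>
    (if a \<in> H then \<forall>e\<in>S. e \<notin> H else \<exists>!e. e \<in> H \<and> e \<in> S)"
  using assms by auto

lemma ex1_mem_3:
  assumes "distinct [a, b, c]"
  shows "(\<exists>!e. e \<in> H \<and> e \<in> {a, b, c}) \<longleftrightarrow>
    (if a \<in> H then b \<notin> H \<and> c \<notin> H else b \<in> H \<longleftrightarrow> c \<notin> H)"
proof -
  have "a \<notin> {b, c}" "b \<notin> {c}" "c \<notin> {}"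
    using assms by auto
  note [simp] = this [THEN ex1_mem_insert]
  show ?thesis
    by (simp del: insert_iff add: Ex1_def)
qed

lemma ex1_mem_4:
  assumes "distinct [a, b, c, d]"
  shows "(\<exists>!e. e \<in> H \<and> e \<in> {a, b, c, d}) \<longleftrightarrow>
    (if a \<in> H then b \<notin> H \<and> c \<notin> H \<and> d \<notin> H else
     if b \<in> H then c \<notin> H \<and> d \<notin> H else c \<in> H \<longleftrightarrow> d \<notin> H)"
proof -
  have "a \<notin> {b, c, d}" "distinct [b, c, d]"
    using assms by auto
  then show ?thesis
    unfolding ex1_mem_insert [OF \<open>a \<notin> {b, c, d}\<close>] ex1_mem_3 [OF \<open>distinct [b, c, d]\<close>] by simp
qed

text \<open>
  The matchings of \<open>K\<^sub>4\<close> with terminals \<open>t\<close>, edges \<open>s\<close> to the fourth vertex and edges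
  \<open>r\<close> between the terminal vertices. The edges are opaque atoms, which keeps the case
  analysis propositional.
\<close>

lemma nine_edge_matchings:
  assumes U: "U = {t0, t1, t2, s0, s1, s2, r01, r02, r12}"
    and dist: "distinct [t0, t1, t2, s0, s1, s2, r01, r02, r12]"
    and M: "M = {H. H \<subseteq> U \<and> (t0 \<in> H \<longleftrightarrow> x0) \<and> (t1 \<in> H \<longleftrightarrow> x1) \<and> (t2 \<in> H \<longleftrightarrow> x2) \<and>
      (\<exists>!e. e \<in> H \<and> e \<in> {t0, s0, r01, r02}) \<and> (\<exists>!e. e \<in> H \<and> e \<in> {t1, s1, r01, r12}) \<and>
      (\<exists>!e. e \<in> H \<and> e \<in> {t2, s2, r02, r12}) \<and> (\<exists>!e. e \<in> H \<and> e \<in> {s0, s1, s2})}"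
  shows "\<not> x0 \<Longrightarrow> \<not> x1 \<Longrightarrow> \<not> x2 \<Longrightarrow> M = {{s0, r12}, {s1, r02}, {s2, r01}}"
    and "x0 \<Longrightarrow> x1 \<Longrightarrow> \<not> x2 \<Longrightarrow> M = {{t0, t1, s2}}"
    and "x0 \<Longrightarrow> \<not> x1 \<Longrightarrow> x2 \<Longrightarrow> M = {{t0, t2, s1}}"
    and "\<not> x0 \<Longrightarrow> x1 \<Longrightarrow> x2 \<Longrightarrow> M = {{t1, t2, s0}}"
proof -
  \<comment> \<open>Subsets of \<open>U\<close> are compared edge by edge, which reduces equality of
    edge sets to nine equivalences.\<close>
  have eq_iff: "H = A \<longleftrightarrow> H \<subseteq> U \<and> (\<forall>e\<in>U. e \<in> H \<longleftrightarrow> e \<in> A)" if "A \<subseteq> U" for H A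
    using that by blast
  have mem_M: "H \<in> M \<longleftrightarrow> H \<subseteq> U \<and> (t0 \<in> H \<longleftrightarrow> x0) \<and> (t1 \<in> H \<longleftrightarrow> x1) \<and> (t2 \<in> H \<longleftrightarrow> x2) \<and>
      (if t0 \<in> H then s0 \<notin> H \<and> r01 \<notin> H \<and> r02 \<notin> H else
       if s0 \<in> H then r01 \<notin> H \<and> r02 \<notin> H else r01 \<in> H \<longleftrightarrow> r02 \<notin> H) \<and>
      (if t1 \<in> H then s1 \<notin> H \<and> r01 \<notin> H \<and> r12 \<notin> H else
       if s1 \<in> H then r01 \<notin> H \<and> r12 \<notin> H else r01 \<in> H \<longleftrightarrow> r12 \<notin> H) \<and>
      (if t2 \<in> H then s2 \<notin> H \<and> r02 \<notin> H \<and> r12 \<notin> H else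
       if s2 \<in> H then r02 \<notin> H \<and> r12 \<notin> H else r02 \<in> H \<longleftrightarrow> r12 \<notin> H) \<and>
      (if s0 \<in> H then s1 \<notin> H \<and> s2 \<notin> H else s1 \<in> H \<longleftrightarrow> s2 \<notin> H)" for H
    unfolding M mem_Collect_eq
    by (intro conj_cong refl ex1_mem_3 ex1_mem_4) (use dist in auto)
  have subs: "{s0, r12} \<subseteq> U" "{s1, r02} \<subseteq> U" "{s2, r01} \<subseteq> U"
    "{t0, t1, s2} \<subseteq> U" "{t0, t2, s1} \<subseteq> U" "{t1, t2, s0} \<subseteq> U"
    by (auto simp: U)
  have ball_U: "(\<forall>e\<in>U. P e) \<longleftrightarrow>
      P t0 \<and> P t1 \<and> P t2 \<and> P s0 \<and> P s1 \<and> P s2 \<and> P r01 \<and> P r02 \<and> P r12" for P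
    by (simp add: U)
  \<comment> \<open>The inequalities between edges are supplied in both orientations.\<close>
  have dist': "distinct (rev [t0, t1, t2, s0, s1, s2, r01, r02, r12])"
    using dist by (simp only: distinct_rev)
  note eq = subs [THEN eq_iff]
  show "\<not> x0 \<Longrightarrow> \<not> x1 \<Longrightarrow> \<not> x2 \<Longrightarrow> M = {{s0, r12}, {s1, r02}, {s2, r01}}"
    using dist dist' unfolding set_eq_iff [of M] insert_iff empty_iff eq ball_U
    by (auto simp: mem_M)
  show "x0 \<Longrightarrow> x1 \<Longrightarrow> \<not> x2 \<Longrightarrow> M = {{t0, t1, s2}}"
    using dist dist' unfolding set_eq_iff [of M] insert_iff empty_iff eq ball_U
    by (auto simp: mem_M)
  show "x0 \<Longrightarrow> \<not> x1 \<Longrightarrow> x2 \<Longrightarrow> M = {{t0, t2, s1}}"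
    using dist dist' unfolding set_eq_iff [of M] insert_iff empty_iff eq ball_U
    by (auto simp: mem_M)
  show "\<not> x0 \<Longrightarrow> x1 \<Longrightarrow> x2 \<Longrightarrow> M = {{t1, t2, s0}}"
    using dist dist' unfolding set_eq_iff [of M] insert_iff empty_iff eq ball_U
    by (auto simp: mem_M)
qed

lemma all_less_3: "(\<forall>i<3. P i) \<longleftrightarrow> P 0 \<and> P 1 \<and> P (2::nat)"
  by (auto simp: numeral_eq_Suc less_Suc_eq)

lemma all_less_4: "(\<forall>i<4. P i) \<longleftrightarrow> P 0 \<and> P 1 \<and> P 2 \<and> P (3::nat)"
  by (auto simp: numeral_eq_Suc less_Suc_eq)

text \<open>Instantiates the opaque edges of \<open>nine_edge_matchings\<close> by pairs of
  vertices. \<open>Internal 3\<close> is the vertex without a terminal. Only even weights are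
  listed, as four internal vertices admit no matching at odd weights.\<close>

lemma K4_matchings:
  fixes x :: "bool list"
  defines "t \<equiv> \<lambda>i. {External i, Internal i}" and "s \<equiv> \<lambda>i. {Internal i, Internal 3}"
    and "r \<equiv> \<lambda>i j. {Internal i, Internal j}"
  defines "M \<equiv> {H. H \<subseteq> t ` {..<3} \<union> {s 0, s 1, s 2, r 0 1, r 0 2, r 1 2} \<and>
    (\<forall>i<3. t i \<in> H \<longleftrightarrow> x ! i) \<and> (\<forall>j<4. \<exists>!e. e \<in> H \<and> Internal j \<in> e)}"
  shows "x = [False, False, False] \<Longrightarrow> M = {{s 0, r 1 2}, {s 1, r 0 2}, {s 2, r 0 1}}"
    and "x = [True, True, False] \<Longrightarrow> M = {{t 0, t 1, s 2}}"
    and "x = [True, False, True] \<Longrightarrow> M = {{t 0, t 2, s 1}}"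
    and "x = [False, True, True] \<Longrightarrow> M = {{t 1, t 2, s 0}}"
proof -
  define U where "U = {t 0, t 1, t 2, s 0, s 1, s 2, r 0 1, r 0 2, r 1 2}"
  have U: "t ` {..<3} \<union> {s 0, s 1, s 2, r 0 1, r 0 2, r 1 2} = U"
    by (auto simp: U_def numeral_3_eq_3 lessThan_Suc numeral_2_eq_2)
  have dist: "distinct [t 0, t 1, t 2, s 0, s 1, s 2, r 0 1, r 0 2, r 1 2]"
    by (simp add: t_def s_def r_def doubleton_eq_iff)
  have inc: "{e \<in> U. Internal 0 \<in> e} = {t 0, s 0, r 0 1, r 0 2}"
    "{e \<in> U. Internal 1 \<in> e} = {t 1, s 1, r 0 1, r 1 2}"
    "{e \<in> U. Internal 2 \<in> e} = {t 2, s 2, r 0 2, r 1 2}"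
    "{e \<in> U. Internal 3 \<in> e} = {s 0, s 1, s 2}"
    unfolding U_def t_def s_def r_def by auto
  \<comment> \<open>Within \<open>U\<close>, the condition at a vertex depends only on its incident
    edges, as computed in \<open>inc\<close>.\<close>
  have ex1: "(\<exists>!e. e \<in> H \<and> v \<in> e) \<longleftrightarrow> (\<exists>!e. e \<in> H \<and> e \<in> {e \<in> U. v \<in> e})" if "H \<subseteq> U" for H v
    using that by (intro arg_cong [where f = Ex1] ext) auto
  have M: "M = {H. H \<subseteq> U \<and> (t 0 \<in> H \<longleftrightarrow> x ! 0) \<and> (t 1 \<in> H \<longleftrightarrow> x ! 1) \<and> (t 2 \<in> H \<longleftrightarrow> x ! 2) \<and>
      (\<exists>!e. e \<in> H \<and> e \<in> {t 0, s 0, r 0 1, r 0 2}) \<and> (\<exists>!e. e \<in> H \<and> e \<in> {t 1, s 1, r 0 1, r 1 2}) \<and>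
      (\<exists>!e. e \<in> H \<and> e \<in> {t 2, s 2, r 0 2, r 1 2}) \<and> (\<exists>!e. e \<in> H \<and> e \<in> {s 0, s 1, s 2})}"
    unfolding M_def U
    by (rule Collect_cong, rule conj_cong [OF refl])
      (simp only: all_less_3 all_less_4 ex1 inc conj_assoc)
  note cases = nine_edge_matchings [OF U_def dist M]
  show "x = [False, False, False] \<Longrightarrow> M = {{s 0, r 1 2}, {s 1, r 0 2}, {s 2, r 0 1}}"
    by (rule cases(1)) simp_all
  show "x = [True, True, False] \<Longrightarrow> M = {{t 0, t 1, s 2}}"
    by (rule cases(2)) simp_all
  show "x = [True, False, True] \<Longrightarrow> M = {{t 0, t 2, s 1}}"
    by (rule cases(3)) simp_all
  show "x = [False, True, True] \<Longrightarrow> M = {{t 1, t 2, s 0}}"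
    by (rule cases(4)) simp_all
qed

section \<open>Constants, and functions with a nonzero coefficient at weight 2\<close>

lemma const_arity_0_in_Match:
  assumes "c \<ge> 0"
  shows "(0, \<lambda>x\<in>cube 0. c) \<in> Match"
\<comment> \<open>Two vertices joined by one edge of weight \<open>c\<close> have a single perfect
  matching. If \<open>c = 0\<close>, the edge is pruned and the matching sum is empty.\<close>
proof (rule Match_intro [where n = 2 and F = "{{Internal 0, Internal 1}}" and w = "\<lambda>_. c"])
  let ?e = "{Internal 0, Internal 1}"
  have "{H. H \<subseteq> {?e} \<and> (\<forall>j<2. \<exists>!e. e \<in> H \<and> Internal j \<in> e)} = {{?e}}"
    by (auto simp: subset_singleton_iff numeral_2_eq_2 less_Suc_eq)
  then show "fourier (0, \<lambda>x\<in>cube 0. c) x =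
      (\<Sum>H | H \<subseteq> (\<lambda>i. {External i, Internal i}) ` {..<0} \<union> {?e} \<and>
        (\<forall>i<0. {External i, Internal i} \<in> H \<longleftrightarrow> x ! i) \<and>
        (\<forall>j<2. \<exists>!e. e \<in> H \<and> Internal j \<in> e). \<Prod>e\<in>H. c)" for x
    by (simp add: fourier_conv_chi cube_0)
qed (use assms in \<open>auto simp: B_all_def B_arity_def cube_0\<close>)

lemma const_arity_3_in_omega_clone:
  assumes "c \<ge> 0"
  shows "(3, \<lambda>x\<in>cube 3. c) \<in> omega_clone Match"
proof -
  have "add_arg 0 (k, \<lambda>x\<in>cube k. c) = (Suc k, \<lambda>x\<in>cube (Suc k). c)" for k
    by (auto simp: add_arg_def cube_def restrict_def fun_eq_iff)
  then have "(Suc k, \<lambda>x\<in>cube (Suc k). c) \<in> omega_clone Match"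
    if "(k, \<lambda>x\<in>cube k. c) \<in> omega_clone Match" for k
    using omega_clone.add_arg [OF that, of 0] by simp
  then show ?thesis
    using omega_clone.base [OF const_arity_0_in_Match [OF assms]]
    by (simp add: numeral_3_eq_3)
qed

lemma cube_3: "cube 3 = {[a, b, c] | a b c. True}"
  by (auto simp: cube_def numeral_3_eq_3 length_Suc_conv)

lemma SDP_3_in_Match:
  assumes f: "(3, f) \<in> SDP" and x: "x \<in> cube 3" "x \<noteq> [False, False, False]" "fourier (3, f) x \<noteq> 0"
  shows "(3, f) \<in> Match"
proof -
  let ?F = "fourier (3, f)"
  let ?s = "\<lambda>i. {Internal i, Internal 3}" and ?r = "\<lambda>i j. {Internal i, Internal j}"
  define c\<^sub>0 where "c\<^sub>0 = ?F [False, False, False]"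
  define c\<^sub>1 where "c\<^sub>1 = ?F [False, True, True]"
  define c\<^sub>2 where "c\<^sub>2 = ?F [True, False, True]"
  define c\<^sub>3 where "c\<^sub>3 = ?F [True, True, False]"
  have nonneg: "c\<^sub>0 \<ge> 0" "c\<^sub>1 \<ge> 0" "c\<^sub>2 \<ge> 0" "c\<^sub>3 \<ge> 0"
    using f by (auto simp: SDP_iff cube_def c\<^sub>0_def c\<^sub>1_def c\<^sub>2_def c\<^sub>3_def)
  have odd: "?F y = 0" if "y \<in> cube 3" "odd (hweight y)" for y
    using f that by (intro fourier_self_dual) (auto simp: SDP_iff)
  \<comment> \<open>Coefficients at odd weights vanish, so \<open>x\<close> has weight 2, which
    makes the denominator of \<open>d\<close> positive.\<close>
  then have "x \<in> {[False, True, True], [True, False, True], [True, True, False]}"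
    using x by (force simp: cube_3)
  then have pos: "c\<^sub>1 + c\<^sub>2 + c\<^sub>3 > 0"
    using x(3) nonneg by (auto simp: c\<^sub>1_def c\<^sub>2_def c\<^sub>3_def)
  \<comment> \<open>At input 0 each of the three matchings pairs one edge to the fourth vertex with
    the opposite edge of weight \<open>d\<close>. This choice makes their weights add up to
    \<open>c\<^sub>0\<close>.\<close>
  define d where "d = c\<^sub>0 / (c\<^sub>1 + c\<^sub>2 + c\<^sub>3)"
  \<comment> \<open>When exactly two terminals are set, the vertex of the third must be matched to
    \<open>Internal 3\<close>. The edge \<open>?s i\<close> therefore carries the coefficient whose
    input is 0 only at position \<open>i\<close>. The default 1 serves the terminals.\<close>
  define w where "w e = (if e = ?s 0 then c\<^sub>1 else if e = ?s 1 then c\<^sub>2 else if e = ?s 2 then c\<^sub>3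
    else if e \<in> {?r 0 1, ?r 0 2, ?r 1 2} then d else 1)" for e
  have "(c\<^sub>1 + c\<^sub>2 + c\<^sub>3) * d = c\<^sub>0"
    using pos by (simp add: d_def)
  then have sum_c0: "c\<^sub>1 * d + (c\<^sub>2 * d + c\<^sub>3 * d) = c\<^sub>0"
    by (simp add: algebra_simps)
  show ?thesis
  proof (rule Match_intro [where n = 4 and F = "{?s 0, ?s 1, ?s 2, ?r 0 1, ?r 0 2, ?r 1 2}" and w = w])
    fix y :: "bool list"
    assume y: "y \<in> cube 3" "even (4::nat) = even (hweight y)"
    then consider "y = [False, False, False]" | "y = [True, True, False]"
      | "y = [True, False, True]" | "y = [False, True, True]"
      by (auto simp: cube_3 split: if_splits)
    then show "?F y = (\<Sum>H | H \<subseteq> (\<lambda>i. {External i, Internal i}) ` {..<3} \<union>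
          {?s 0, ?s 1, ?s 2, ?r 0 1, ?r 0 2, ?r 1 2} \<and>
        (\<forall>i<3. {External i, Internal i} \<in> H \<longleftrightarrow> y ! i) \<and>
        (\<forall>j<4. \<exists>!e. e \<in> H \<and> Internal j \<in> e). \<Prod>e\<in>H. w e)"
    proof cases
      case 1
      then show ?thesis
        unfolding K4_matchings(1) [OF 1]
        using sum_c0 by (simp add: w_def doubleton_eq_iff flip: c\<^sub>0_def)
    next
      case 2
      then show ?thesis
        unfolding K4_matchings(2) [OF 2] by (simp add: w_def doubleton_eq_iff c\<^sub>3_def)
    next
      case 3
      then show ?thesis
        unfolding K4_matchings(3) [OF 3] by (simp add: w_def doubleton_eq_iff c\<^sub>2_def)
    next
      case 4
      then show ?thesis
        unfolding K4_matchings(4) [OF 4] by (simp add: w_def doubleton_eq_iff c\<^sub>1_def)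
    qed
  next
    show "(3, f) \<in> B_all"
      using f by (simp add: SDP_def)
    show "?F y = 0" if "y \<in> cube 3" "even (4::nat) \<noteq> even (hweight y)" for y
      using that by (simp add: odd)
    have "d \<ge> 0"
      using nonneg by (simp add: d_def)
    then show "e \<subseteq> Internal ` {..<4} \<and> card e = 2 \<and> w e \<ge> 0"
      if "e \<in> {?s 0, ?s 1, ?s 2, ?r 0 1, ?r 0 2, ?r 1 2}" for e
      using that nonneg by (auto simp: w_def)
    show "w e = 1" if e: "e \<in> (\<lambda>i. {External i, Internal i}) ` {..<3}" for e
    proof -
      obtain i where "e = {External i, Internal i}"
        using e by blast
      then show ?thesis
        by (simp add: w_def doubleton_eq_iff)
    qed
  qed simp
qed

lemma SDP_3_in_omega_clone:
  assumes f: "(3, f) \<in> SDP"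
  shows "(3, f) \<in> omega_clone Match"
proof (cases "\<exists>x\<in>cube 3. x \<noteq> [False, False, False] \<and> fourier (3, f) x \<noteq> 0")
  case True
  then show ?thesis
    using SDP_3_in_Match [OF f] by (auto intro: omega_clone.base)
next
  case False
  let ?c = "fourier (3, f) [False, False, False]"
  have mem: "[False, False, False] \<in> cube 3"
    by (simp add: cube_def)
  have "f w = ?c" if w: "w \<in> cube 3" for w
  proof -
    have "f w = (\<Sum>x\<in>cube 3. fourier (3, f) x * chi w x)"
      by (rule fourier_inversion [OF w])
    \<comment> \<open>Only the zero character survives, and it is constantly 1.\<close>
    also have "\<dots> = (\<Sum>x\<in>cube 3. if x = [False, False, False] then ?c else 0)"
      using False w by (intro sum.cong refl) (auto simp: cube_3)
    finally show ?thesis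
      using mem by simp
  qed
  moreover have "f \<in> extensional (cube 3)"
    using f by (auto simp: SDP_iff PiE_iff)
  ultimately have "f = (\<lambda>x\<in>cube 3. ?c)"
    by (intro extensionalityI [where A = "cube 3"]) auto
  moreover have "?c \<ge> 0"
    using f mem by (auto simp: SDP_iff)
  ultimately show ?thesis
    using const_arity_3_in_omega_clone by metis
qed

theorem theorem12p1: "arity_part SDP 3 = arity_part (omega_clone Match) 3"
  using omega_clone_subset_SDP [OF Match_subset_SDP] SDP_3_in_omega_clone
  by (auto simp: arity_part_def B_arity_def)

end
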